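(* Let $n\ge 2$, let $\mathbf P=(p_{ij})$ be the t-SNE similarity matrix of the data, and let $y_i^{(k)}\in\mathbb R^2$ be the early-exaggeration iterates with parameters $\alpha,h>0$. Put $\eta^{(k)}=[\mathrm{diam}(\{y_i^{(k)}\}_{1\le i\le n})]^2$. Then for any $i,j\in[n]$ with $i\neq j$ and each $k\ge 1$ such that $\eta^{(k)}<1$, $$\Big|S_{ij}^{(k)}(\alpha)-\alpha p_{ij}+\frac{1}{n(n-1)}\Big|\le \alpha p_{ij}\eta^{(k)}+\frac{2\eta^{(k)}}{n(n-1)(1-\eta^{(k)})}.$$ Consequently, with $\mathbf H_n=\frac{1}{n(n-1)}(\mathbf 1_n\mathbf 1_n^\top-\mathbf I_n)$, for each $k\ge1$, as long as $(\eta^{(k)},\alpha)$ satisfies $$\eta^{(k)}\ll\frac{\|\mathbf P\|}{n\|\mathbf P\|_\infty},\qquad \alpha\gg\frac{1}{n\|\mathbf P\|}\qquad (n\to\infty),$$ we have $$\lim_{n\to\infty}\frac{\|\mathbf S_\alpha^{(k)}-(\alpha\mathbf P-\mathbf H_n)\|}{\|\alpha\mathbf P-\mathbf H_n\|}=0.$$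
   Context: For each $n\ge2$ there are data points $X_1,\dots,X_n\in\mathbb R^p$ ($p$ and the data may depend on $n$) and bandwidths $\tau_i>0$. The matrix $\mathbf P=(p_{ij})\in\mathbb R^{n\times n}$ is given by $p_{ii}=0$ and, for $i\ne j$, $p_{ij}=\frac{p_{i|j}+p_{j|i}}{2n}$ with $p_{j|i}=\frac{\exp(-\|X_i-X_j\|_2^2/2\tau_i^2)}{\sum_{\ell\ne i}\exp(-\|X_i-X_\ell\|_2^2/2\tau_i^2)}$. Early exaggeration iterates: from an initialization $y_1^{(0)},\dots,y_n^{(0)}\in\mathbb R^2$ and parameters $\alpha>0$ (exaggeration), $h>0$ (step size), $y_i^{(k+1)}=y_i^{(k)}+h\sum_{j\ne i}(y_j^{(k)}-y_i^{(k)})S_{ij}^{(k)}(\alpha)$, where for $i\ne j$, $S_{ij}^{(k)}(\alpha)=\frac{\alpha p_{ij}-q_{ij}^{(k)}}{1+\|y_i^{(k)}-y_j^{(k)}\|_2^2}$ and $q_{ij}^{(k)}=\frac{(1+\|y_i^{(k)}-y_j^{(k)}\|_2^2)^{-1}}{\sum_{\ell\ne s}(1+\|y_\ell^{(k)}-y_s^{(k)}\|_2^2)^{-1}}$; $S_{ii}^{(k)}(\alpha)=0$; $\mathbf S_\alpha^{(k)}=(S_{ij}^{(k)}(\alpha))_{i,j}$. Notation: $\|\cdot\|$ is the spectral norm, $\|\mathbf A\|_\infty=\max_{i,j}|a_{ij}|$ for matrices, $\mathrm{diam}(S)=\sup_{x,y\in S}\|x-y\|_2$, $\mathbf 1_n$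 the all-ones vector. All quantities ($\alpha,h,k$, initialization) may depend on $n$; $a_n\ll b_n$ (equivalently $b_n\gg a_n$) means $a_n/b_n\to0$ as $n\to\infty$. *)

theory Defs
  imports "HOL-Analysis.Analysis" "Jordan_Normal_Form.Matrix"
begin

text \<open>
  Matrices whose size varies with \<open>n\<close>, and data vectors whose dimension may vary with \<open>n\<close>,
  are matrices and vectors with explicit dimensions; the indices \<open>1, \<dots>, n\<close> are shifted to
  \<open>0, \<dots>, n - 1\<close>. The low-dimensional embedding lives in the type \<open>real ^ 2\<close>, and a
  configuration of \<open>n\<close> points is a function on \<open>nat\<close> of which only the values below \<open>n\<close> matter.
\<close>

definition l2_norm :: "real Matrix.vec \<Rightarrow> real" where
  "l2_norm v = sqrt (scalar_prod v v)"

text \<open>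
  The operator norm induced by the Euclidean norm. The supremum is over a nonempty set, and
  hence meaningful, as soon as the matrix has at least one column.
\<close>

definition spectral_norm :: "real mat \<Rightarrow> real" where
  "spectral_norm A =
     (SUP v \<in> {v \<in> carrier_vec (dim_col A). l2_norm v = 1}. l2_norm (A *\<^sub>v v))"

text \<open>The entrywise maximum norm, not the operator norm induced by the sup norm.\<close>

definition max_norm :: "real mat \<Rightarrow> real" where
  "max_norm A = Max (abs ` elements_mat A)"

text \<open>\<open>cond_similarity n X \<tau> i j\<close> is $p_{j|i}$: the conditioning index comes first.\<close>

definition cond_similarity ::
  "nat \<Rightarrow> (nat \<Rightarrow> real Matrix.vec) \<Rightarrow> (nat \<Rightarrow> real) \<Rightarrow> nat \<Rightarrow> nat \<Rightarrow> real" where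
  "cond_similarity n X \<tau> i j =
     exp (- ((l2_norm (X i - X j))\<^sup>2 / (2 * (\<tau> i)\<^sup>2))) /
     (\<Sum>l \<in> {..<n} - {i}. exp (- ((l2_norm (X i - X l))\<^sup>2 / (2 * (\<tau> i)\<^sup>2))))"

definition similarity_matrix ::
  "nat \<Rightarrow> (nat \<Rightarrow> real Matrix.vec) \<Rightarrow> (nat \<Rightarrow> real) \<Rightarrow> real mat" where
  "similarity_matrix n X \<tau> = mat n n (\<lambda>(i, j).
     if i = j then 0
     else (cond_similarity n X \<tau> j i + cond_similarity n X \<tau> i j) / (2 * real n))"

definition emb_similarity :: "nat \<Rightarrow> (nat \<Rightarrow> real ^ 2) \<Rightarrow> nat \<Rightarrow> nat \<Rightarrow> real" where
  "emb_similarity n y i j =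
     inverse (1 + (norm (y i - y j))\<^sup>2) /
     (\<Sum>(l, s) \<in> {(l, s). l < n \<and> s < n \<and> l \<noteq> s}. inverse (1 + (norm (y l - y s))\<^sup>2))"

definition S_matrix :: "nat \<Rightarrow> real mat \<Rightarrow> real \<Rightarrow> (nat \<Rightarrow> real ^ 2) \<Rightarrow> real mat" where
  "S_matrix n P \<alpha> y = mat n n (\<lambda>(i, j).
     if i = j then 0
     else (\<alpha> * P $$ (i, j) - emb_similarity n y i j) / (1 + (norm (y i - y j))\<^sup>2))"

definition ee_step ::
  "nat \<Rightarrow> real mat \<Rightarrow> real \<Rightarrow> real \<Rightarrow> (nat \<Rightarrow> real ^ 2) \<Rightarrow> (nat \<Rightarrow> real ^ 2)" where
  "ee_step n P \<alpha> h y = (\<lambda>i.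
     y i + h *\<^sub>R (\<Sum>j \<in> {..<n} - {i}. S_matrix n P \<alpha> y $$ (i, j) *\<^sub>R (y j - y i)))"

definition ee_iterate ::
  "nat \<Rightarrow> real mat \<Rightarrow> real \<Rightarrow> real \<Rightarrow> (nat \<Rightarrow> real ^ 2) \<Rightarrow> nat \<Rightarrow> (nat \<Rightarrow> real ^ 2)" where
  "ee_iterate n P \<alpha> h y0 k = (ee_step n P \<alpha> h ^^ k) y0"

definition sq_diam :: "nat \<Rightarrow> (nat \<Rightarrow> real ^ 2) \<Rightarrow> real" where
  "sq_diam n y = (diameter (y ` {..<n}))\<^sup>2"

definition ones_col :: "nat \<Rightarrow> real mat" where
  "ones_col n = mat n 1 (\<lambda>_. 1)"

definition H_matrix :: "nat \<Rightarrow> real mat" where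
  "H_matrix n = (1 / (real n * (real n - 1))) \<cdot>\<^sub>m
     (ones_col n * transpose_mat (ones_col n) - 1\<^sub>m n)"

end

theory Submission
  imports Defs
begin

text \<open>
  Since \<open>|S - (\<alpha>P - H)| \<le> \<alpha>\<eta>P + (2\<eta>/(1 - \<eta>))H\<close> entrywise and the spectral norm is monotone on
  nonnegative matrices, the numerator is at most \<open>\<alpha>\<eta>\<parallel>P\<parallel> + (2\<eta>/(1 - \<eta>))\<parallel>H\<parallel>\<close>. The condition on
  \<open>\<eta>\<close> forces \<open>\<eta> \<rightarrow> 0\<close> because \<open>\<parallel>P\<parallel> \<le> n\<parallel>P\<parallel>\<^sub>\<infinity>\<close>, and the condition on \<open>\<alpha>\<close> makes
  \<open>\<parallel>H\<parallel> \<le> 2/n\<close> negligible against \<open>\<alpha>\<parallel>P\<parallel>\<close>.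
\<close>

section \<open>Euclidean norm of vectors with explicit dimension\<close>

lemma l2_norm_eq_L2_set: "l2_norm v = L2_set (vec_index v) {..<dim_vec v}"
  by (simp add: l2_norm_def L2_set_def scalar_prod_def power2_eq_square lessThan_atLeast0)

lemma l2_norm_nonneg [simp]: "0 \<le> l2_norm v"
  by (simp add: l2_norm_eq_L2_set)

lemma l2_norm_smult: "l2_norm (c \<cdot>\<^sub>v v) = \<bar>c\<bar> * l2_norm v"
proof -
  have "(c \<cdot>\<^sub>v v) \<bullet> (c \<cdot>\<^sub>v v) = c\<^sup>2 * (v \<bullet> v)"
    by (simp add: scalar_prod_def sum_distrib_left power2_eq_square algebra_simps)
  then show ?thesis
    by (simp add: l2_norm_def real_sqrt_mult)
qed

lemma l2_norm_mono:
  assumes "dim_vec v = dim_vec w" "\<And>i. i < dim_vec w \<Longrightarrow> \<bar>vec_index v i\<bar> \<le> vec_index w i"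
  shows "l2_norm v \<le> l2_norm w"
proof -
  have "L2_set (\<lambda>i. \<bar>vec_index v i\<bar>) {..<dim_vec w} \<le> L2_set (vec_index w) {..<dim_vec w}"
    using assms(2) by (intro L2_set_mono) auto
  then show ?thesis
    using assms(1) by (simp add: l2_norm_eq_L2_set L2_set_def)
qed

lemma l2_norm_add_le:
  assumes "dim_vec v = dim_vec w"
  shows "l2_norm (v + w) \<le> l2_norm v + l2_norm w"
proof -
  have "l2_norm (v + w) = L2_set (\<lambda>i. vec_index v i + vec_index w i) {..<dim_vec w}"
    unfolding l2_norm_eq_L2_set by (intro L2_set_cong) auto
  also have "\<dots> \<le> l2_norm v + l2_norm w"
    unfolding l2_norm_eq_L2_set assms by (rule L2_set_triangle_ineq)
  finally show ?thesis .
qed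

lemma abs_index_le_l2_norm: "i < dim_vec v \<Longrightarrow> \<bar>vec_index v i\<bar> \<le> l2_norm v"
  using member_le_L2_set[of "{..<dim_vec v}" i "\<lambda>i. \<bar>vec_index v i\<bar>"]
  by (simp add: l2_norm_eq_L2_set L2_set_def)

lemma l2_norm_unit_vec: "j < n \<Longrightarrow> l2_norm (unit_vec n j) = 1"
  by (simp add: l2_norm_def)

section \<open>Matrix-vector products and the spectral norm\<close>

lemma index_mult_mat_vec_sum:
  assumes "i < dim_row A" "v \<in> carrier_vec (dim_col A)"
  shows "vec_index (A *\<^sub>v v) i = (\<Sum>j<dim_col A. A $$ (i, j) * vec_index v j)"
  using assms by (simp add: scalar_prod_def lessThan_atLeast0)

text \<open>Cauchy-Schwarz bounds every coordinate of the image by one constant. The estimate makes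
  the supremum in \<open>spectral_norm\<close> bounded, and it later compares the spectral norm with
  the largest entry.\<close>

lemma l2_norm_mult_mat_vec_le_entries:
  assumes v: "v \<in> carrier_vec (dim_col A)"
    and c: "\<And>i j. i < dim_row A \<Longrightarrow> j < dim_col A \<Longrightarrow> \<bar>A $$ (i, j)\<bar> \<le> c" "0 \<le> c"
  shows "l2_norm (A *\<^sub>v v) \<le> sqrt (dim_row A) * sqrt (dim_col A) * c * l2_norm v"
proof -
  define K where "K = c * (sqrt (dim_col A) * l2_norm v)"
  have K0: "0 \<le> K" using c(2) by (simp add: K_def)
  have "\<bar>vec_index (A *\<^sub>v v) i\<bar> \<le> K" if i: "i < dim_row A" for i
  proof -
    have "\<bar>vec_index (A *\<^sub>v v) i\<bar> \<le> (\<Sum>j<dim_col A. \<bar>A $$ (i, j) * vec_index v j\<bar>)"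
      unfolding index_mult_mat_vec_sum[OF i v] by (rule sum_abs)
    \<comment> \<open>The factor \<open>\<bar>1\<bar>\<close> exhibits the row sum as a product with
      the all-ones vector, whose norm \<open>sqrt (dim_col A)\<close> enters through
      Cauchy-Schwarz.\<close>
    also have "\<dots> \<le> (\<Sum>j<dim_col A. c * (\<bar>1\<bar> * \<bar>vec_index v j\<bar>))"
      using c i by (intro sum_mono) (auto simp: abs_mult intro!: mult_right_mono)
    also have "\<dots> = c * (\<Sum>j<dim_col A. \<bar>1\<bar> * \<bar>vec_index v j\<bar>)"
      by (rule sum_distrib_left[symmetric])
    also have "\<dots> \<le> c * (L2_set (\<lambda>_. 1) {..<dim_col A} * L2_set (vec_index v) {..<dim_col A})"
      using c(2) by (intro mult_left_mono L2_set_mult_ineq)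
    also have "\<dots> = K"
      using v by (auto simp: K_def l2_norm_eq_L2_set L2_set_def)
    finally show ?thesis .
  qed
  then have "l2_norm (A *\<^sub>v v) \<le> l2_norm (Matrix.vec (dim_row A) (\<lambda>_. K))"
    by (intro l2_norm_mono) auto
  also have "\<dots> = sqrt (dim_row A) * K"
    using K0 by (simp add: l2_norm_eq_L2_set L2_set_def real_sqrt_mult)
  finally show ?thesis by (simp add: K_def mult_ac)
qed

lemma abs_index_le_max_norm:
  assumes "i < dim_row A" "j < dim_col A"
  shows "\<bar>A $$ (i, j)\<bar> \<le> max_norm A"
proof -
  have "elements_mat A = (\<lambda>(i, j). A $$ (i, j)) ` ({..<dim_row A} \<times> {..<dim_col A})"
    by (auto simp: elements_mat_def)
  then have "finite (elements_mat A)" by simp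
  moreover have "A $$ (i, j) \<in> elements_mat A"
    using assms by auto
  ultimately show ?thesis
    unfolding max_norm_def by (intro Max_ge) auto
qed

text \<open>The supremum runs over unit vectors only, so \<open>v\<close> is rescaled to norm 1. A
  vector of norm 0 cannot be rescaled and is treated first.\<close>

lemma l2_norm_mult_mat_vec_le:
  assumes v: "v \<in> carrier_vec (dim_col A)"
  shows "l2_norm (A *\<^sub>v v) \<le> spectral_norm A * l2_norm v"
proof (cases "l2_norm v = 0")
  case True
  \<comment> \<open>Any finite multiple of \<open>l2_norm v\<close> will do here. The absolute value
    makes the constant nonnegative even for a matrix without entries, where \<open>max_norm\<close>
    is the maximum of an empty set.\<close>
  have "l2_norm (A *\<^sub>v v) \<le> sqrt (dim_row A) * sqrt (dim_col A) * \<bar>max_norm A\<bar> * l2_norm v"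
    using v abs_index_le_max_norm[of _ A]
    by (intro l2_norm_mult_mat_vec_le_entries) (auto intro: order_trans[OF _ abs_ge_self])
  then show ?thesis using True by simp
next
  case False
  define u where "u = (1 / l2_norm v) \<cdot>\<^sub>v v"
  have u: "u \<in> carrier_vec (dim_col A)" "l2_norm u = 1"
    using v False by (auto simp: u_def l2_norm_smult)
  have "bdd_above ((\<lambda>v. l2_norm (A *\<^sub>v v)) ` {v \<in> carrier_vec (dim_col A). l2_norm v = 1})"
  proof (rule bdd_aboveI2)
    fix w assume "w \<in> {v \<in> carrier_vec (dim_col A). l2_norm v = 1}"
    then show "l2_norm (A *\<^sub>v w) \<le> sqrt (dim_row A) * sqrt (dim_col A) * \<bar>max_norm A\<bar>"
      using l2_norm_mult_mat_vec_le_entries[of w A "\<bar>max_norm A\<bar>"] abs_index_le_max_norm[of _ A]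
      by (auto intro: order_trans[OF _ abs_ge_self])
  qed
  then have "l2_norm (A *\<^sub>v u) \<le> spectral_norm A"
    unfolding spectral_norm_def using u by (intro cSUP_upper) auto
  moreover have "A *\<^sub>v u = (1 / l2_norm v) \<cdot>\<^sub>v (A *\<^sub>v v)"
    unfolding u_def using v by (intro mult_mat_vec) auto
  ultimately have "l2_norm (A *\<^sub>v v) / l2_norm v \<le> spectral_norm A"
    by (simp add: l2_norm_smult)
  moreover have "l2_norm v > 0"
    using False l2_norm_nonneg[of v] by linarith
  ultimately show ?thesis by (simp add: divide_le_eq)
qed

text \<open>A positive number of columns guarantees a unit vector, so the supremum is over a
  nonempty set and is the least such constant \<open>c\<close>.\<close>

lemma spectral_norm_le:
  assumes "0 < dim_col A"
    and "\<And>v. v \<in> carrier_vec (dim_col A) \<Longrightarrow> l2_norm (A *\<^sub>v v) \<le> c * l2_norm v"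
  shows "spectral_norm A \<le> c"
  unfolding spectral_norm_def
proof (rule cSUP_least)
  show "{v \<in> carrier_vec (dim_col A). l2_norm v = 1} \<noteq> {}"
    using l2_norm_unit_vec[OF assms(1)] unit_vec_carrier by blast
qed (use assms(2) in fastforce)

lemma spectral_norm_le_entries:
  assumes "0 < dim_col A"
    and "\<And>i j. i < dim_row A \<Longrightarrow> j < dim_col A \<Longrightarrow> \<bar>A $$ (i, j)\<bar> \<le> c" "0 \<le> c"
  shows "spectral_norm A \<le> sqrt (dim_row A) * sqrt (dim_col A) * c"
  using assms by (intro spectral_norm_le l2_norm_mult_mat_vec_le_entries) auto

text \<open>An entry is a coordinate of the image of a standard basis vector. This is also the
  source of nonnegativity and strict positivity of spectral norms below.\<close>

lemma abs_index_le_spectral_norm: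
  assumes "i < dim_row A" "j < dim_col A"
  shows "\<bar>A $$ (i, j)\<bar> \<le> spectral_norm A"
proof -
  have "vec_index (A *\<^sub>v unit_vec (dim_col A) j) i = A $$ (i, j)"
    using assms by simp
  then have "\<bar>A $$ (i, j)\<bar> \<le> l2_norm (A *\<^sub>v unit_vec (dim_col A) j)"
    using abs_index_le_l2_norm[of i "A *\<^sub>v unit_vec (dim_col A) j"] assms by simp
  also have "\<dots> \<le> spectral_norm A"
    using l2_norm_mult_mat_vec_le[of "unit_vec (dim_col A) j" A] assms
    by (simp add: l2_norm_unit_vec)
  finally show ?thesis .
qed

lemma spectral_norm_add_le:
  assumes A: "A \<in> carrier_mat m n" and B: "B \<in> carrier_mat m n" and n: "0 < n"
  shows "spectral_norm (A + B) \<le> spectral_norm A + spectral_norm B"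
proof (rule spectral_norm_le)
  fix v :: "real Matrix.vec" assume "v \<in> carrier_vec (dim_col (A + B))"
  then have v: "v \<in> carrier_vec n" using B by simp
  have "l2_norm ((A + B) *\<^sub>v v) = l2_norm (A *\<^sub>v v + B *\<^sub>v v)"
    using A B v by (simp add: add_mult_distrib_mat_vec)
  also have "\<dots> \<le> l2_norm (A *\<^sub>v v) + l2_norm (B *\<^sub>v v)"
    using A B by (intro l2_norm_add_le) simp
  also have "\<dots> \<le> (spectral_norm A + spectral_norm B) * l2_norm v"
    using l2_norm_mult_mat_vec_le[of v A] l2_norm_mult_mat_vec_le[of v B] A B v
    by (simp add: distrib_right)
  finally show "l2_norm ((A + B) *\<^sub>v v) \<le> (spectral_norm A + spectral_norm B) * l2_norm v" .
qed (use B n in simp)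

lemma smult_mat_mult_mat_vec:
  fixes A :: "real mat"
  assumes "v \<in> carrier_vec (dim_col A)"
  shows "(c \<cdot>\<^sub>m A) *\<^sub>v v = c \<cdot>\<^sub>v (A *\<^sub>v v)"
  using assms by (intro eq_vecI) auto

lemma spectral_norm_smult_le:
  assumes "0 < dim_col A"
  shows "spectral_norm (c \<cdot>\<^sub>m A) \<le> \<bar>c\<bar> * spectral_norm A"
proof (rule spectral_norm_le)
  fix v :: "real Matrix.vec" assume "v \<in> carrier_vec (dim_col (c \<cdot>\<^sub>m A))"
  then have v: "v \<in> carrier_vec (dim_col A)" by simp
  then show "l2_norm ((c \<cdot>\<^sub>m A) *\<^sub>v v) \<le> \<bar>c\<bar> * spectral_norm A * l2_norm v"
    using l2_norm_mult_mat_vec_le[OF v] mult_left_mono[of _ _ "\<bar>c\<bar>"]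
    by (simp add: smult_mat_mult_mat_vec l2_norm_smult mult.assoc)
qed (use assms in simp)

text \<open>The reverse inequality comes from the upper bound applied to the factor
  \<open>1 / c\<close> and the matrix already scaled by \<open>c\<close>.\<close>

lemma spectral_norm_smult:
  assumes "0 < dim_row A" "0 < dim_col A"
  shows "spectral_norm (c \<cdot>\<^sub>m A) = \<bar>c\<bar> * spectral_norm A"
proof (rule antisym)
  show "\<bar>c\<bar> * spectral_norm A \<le> spectral_norm (c \<cdot>\<^sub>m A)"
  proof (cases "c = 0")
    case True
    \<comment> \<open>The left side vanishes, so only nonnegativity of a spectral norm is at stake;
      the entry at (0, 0) provides it.\<close>
    then show ?thesis
      using abs_index_le_spectral_norm[of 0 "c \<cdot>\<^sub>m A" 0] assms by simp
  next
    case False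
    then have "(1 / c) \<cdot>\<^sub>m (c \<cdot>\<^sub>m A) = A"
      by (intro eq_matI) auto
    then show ?thesis
      using spectral_norm_smult_le[of "c \<cdot>\<^sub>m A" "1 / c"] assms False
      by (simp add: field_simps)
  qed
qed (rule spectral_norm_smult_le[OF assms(2)])

text \<open>
  Replacing \<open>v\<close> by its entrywise absolute value keeps its norm and can only enlarge the
  image under the dominating matrix.
\<close>

lemma spectral_norm_mono:
  assumes dim: "dim_row A = dim_row B" "dim_col A = dim_col B" "0 < dim_col B"
    and le: "\<And>i j. i < dim_row B \<Longrightarrow> j < dim_col B \<Longrightarrow> \<bar>A $$ (i, j)\<bar> \<le> B $$ (i, j)"
  shows "spectral_norm A \<le> spectral_norm B"
proof (rule spectral_norm_le)
  fix v :: "real Matrix.vec" assume "v \<in> carrier_vec (dim_col A)"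
  then have v: "v \<in> carrier_vec (dim_col A)" "v \<in> carrier_vec (dim_col B)"
    using dim by auto
  define w where "w = map_vec abs v"
  have w: "w \<in> carrier_vec (dim_col B)" using v by (simp add: w_def)
  have norm_w: "l2_norm w = l2_norm v"
    by (auto simp: w_def l2_norm_eq_L2_set L2_set_def)
  have "\<bar>vec_index (A *\<^sub>v v) i\<bar> \<le> vec_index (B *\<^sub>v w) i" if i: "i < dim_row B" for i
  proof -
    have "\<bar>vec_index (A *\<^sub>v v) i\<bar> \<le> (\<Sum>j<dim_col A. \<bar>A $$ (i, j) * vec_index v j\<bar>)"
      using i dim v(1) by (subst index_mult_mat_vec_sum) auto
    also have "\<dots> \<le> (\<Sum>j<dim_col A. B $$ (i, j) * vec_index w j)"
      using le i v dim by (intro sum_mono) (auto simp: abs_mult w_def intro!: mult_right_mono)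
    also have "\<dots> = vec_index (B *\<^sub>v w) i"
      using index_mult_mat_vec_sum[OF i w] dim by simp
    finally show ?thesis .
  qed
  then have "l2_norm (A *\<^sub>v v) \<le> l2_norm (B *\<^sub>v w)"
    using dim by (intro l2_norm_mono) auto
  also have "\<dots> \<le> spectral_norm B * l2_norm v"
    using l2_norm_mult_mat_vec_le[OF w] norm_w by simp
  finally show "l2_norm (A *\<^sub>v v) \<le> spectral_norm B * l2_norm v" .
qed (use dim in simp)

section \<open>Entries of the similarity matrix and of \<open>H_matrix\<close>\<close>

lemma cond_similarity_pos:
  assumes "i < n" "j < n" "i \<noteq> j"
  shows "0 < cond_similarity n X \<tau> i j"
  unfolding cond_similarity_def using assms
  by (intro divide_pos_pos exp_gt_zero sum_pos) auto

lemma similarity_matrix_carrier: "similarity_matrix n X \<tau> \<in> carrier_mat n n"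
  by (simp add: similarity_matrix_def)

lemma similarity_matrix_pos:
  assumes "i < n" "j < n" "i \<noteq> j"
  shows "0 < similarity_matrix n X \<tau> $$ (i, j)"
  using assms by (simp add: similarity_matrix_def cond_similarity_pos add_pos_pos)

lemma similarity_matrix_diag: "i < n \<Longrightarrow> similarity_matrix n X \<tau> $$ (i, i) = 0"
  by (simp add: similarity_matrix_def)

lemma H_matrix_carrier: "H_matrix n \<in> carrier_mat n n"
  by (simp add: H_matrix_def ones_col_def minus_mat_def)

lemma H_matrix_index:
  assumes "i < n" "j < n"
  shows "H_matrix n $$ (i, j) = (if i = j then 0 else 1 / (real n * (real n - 1)))"
  using assms by (auto simp: H_matrix_def ones_col_def scalar_prod_def)

text \<open>An \<open>n\<close> by \<open>n\<close> matrix with entries at most \<open>c\<close> has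
  norm at most \<open>n * c\<close>, here \<open>1 / (n - 1)\<close>; the assumption
  \<open>2 \<le> n\<close> turns this into \<open>2 / n\<close>.\<close>

lemma spectral_norm_H_matrix_le:
  assumes "2 \<le> n"
  shows "spectral_norm (H_matrix n) \<le> 2 / real n"
proof -
  define c where "c = 1 / (real n * (real n - 1))"
  have "spectral_norm (H_matrix n) \<le> sqrt (dim_row (H_matrix n)) * sqrt (dim_col (H_matrix n)) * c"
  proof (rule spectral_norm_le_entries)
    show "0 < dim_col (H_matrix n)"
      using assms H_matrix_carrier[of n] by auto
    show "0 \<le> c"
      using assms by (simp add: c_def)
    fix i j assume "i < dim_row (H_matrix n)" "j < dim_col (H_matrix n)"
    then show "\<bar>H_matrix n $$ (i, j)\<bar> \<le> c"
      using assms H_matrix_carrier[of n] by (auto simp: c_def H_matrix_index)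
  qed
  also have "\<dots> = 1 / (real n - 1)"
    using assms H_matrix_carrier[of n] by (simp add: c_def)
  also have "\<dots> \<le> 2 / real n"
    using assms by (simp add: field_simps)
  finally show ?thesis .
qed

section \<open>Embedding similarities and the deviation of \<open>S_matrix\<close> from
  \<open>\<alpha>P - H\<close>\<close>

lemma sq_dist_le_sq_diam:
  assumes "i < n" "j < n"
  shows "(norm (y i - y j))\<^sup>2 \<le> sq_diam n y"
proof -
  have "dist (y i) (y j) \<le> diameter (y ` {..<n})"
    using assms by (intro diameter_bounded_bound finite_imp_bounded) auto
  then show ?thesis
    unfolding sq_diam_def by (intro power_mono) (auto simp: dist_norm)
qed

lemma card_off_diagonal:
  "real (card {(l, s). l < n \<and> s < n \<and> l \<noteq> s}) = real n * (real n - 1)"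
proof -
  have "{(l, s). l < n \<and> s < n \<and> l \<noteq> s} = {..<n} \<times> {..<n} - (\<lambda>l. (l, l)) ` {..<n}"
    by auto
  moreover have "card ({..<n} \<times> {..<n} - (\<lambda>l. (l, l)) ` {..<n}) = n * n - n"
    by (subst card_Diff_subset) (auto simp: card_image inj_on_def card_cartesian_product)
  \<comment> \<open>The subtraction \<open>n * n - n\<close> is truncated, hence the case
    distinction before passing to the reals.\<close>
  ultimately show ?thesis
    by (cases n) (auto simp: algebra_simps)
qed

text \<open>Every kernel value lies between \<open>1 / (1 + e)\<close> and 1, so the normalizing sum
  over \<open>N\<close> ordered pairs lies between \<open>N / (1 + e)\<close> and \<open>N\<close>.
  Dividing opposite extremes gives both bounds.\<close>

lemma emb_similarity_bounds:
  fixes y :: "nat \<Rightarrow> real ^ 2"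
  assumes ij: "i < n" "j < n" "i \<noteq> j"
  defines "N \<equiv> real n * (real n - 1)" and "e \<equiv> sq_diam n y"
  shows "1 / ((1 + e) * N) \<le> emb_similarity n y i j" "emb_similarity n y i j \<le> (1 + e) / N"
proof -
  define g where "g = (\<lambda>(l, s). inverse (1 + (norm (y l - y s))\<^sup>2))"
  define I where "I = {(l, s). l < n \<and> s < n \<and> l \<noteq> s}"
  have e: "0 \<le> e" by (simp add: e_def sq_diam_def)
  have N: "0 < N" using ij by (auto simp: N_def)
  have g: "inverse (1 + e) \<le> g z \<and> g z \<le> 1" if "z \<in> I" for z
  proof -
    obtain l s where z: "z = (l, s)" "l < n" "s < n"
      using \<open>z \<in> I\<close> by (auto simp: I_def)
    have "(norm (y l - y s))\<^sup>2 \<le> e"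
      using z sq_dist_le_sq_diam by (auto simp: e_def)
    moreover have "0 \<le> (norm (y l - y s))\<^sup>2" by simp
    ultimately have "0 < 1 + (norm (y l - y s))\<^sup>2" "1 + (norm (y l - y s))\<^sup>2 \<le> 1 + e"
      by linarith+
    then show ?thesis
      unfolding g_def z(1) prod.case by (auto intro: le_imp_inverse_le simp: inverse_le_1_iff)
  qed
  have lower: "N * inverse (1 + e) \<le> sum g I"
    using sum_bounded_below[of I "inverse (1 + e)" g] g card_off_diagonal[of n]
    by (simp add: I_def N_def)
  have upper: "sum g I \<le> N"
    using sum_bounded_above[of I g 1] g card_off_diagonal[of n] by (simp add: I_def N_def)
  have q: "emb_similarity n y i j = g (i, j) / sum g I"
    by (simp add: emb_similarity_def g_def I_def)
  have gij: "inverse (1 + e) \<le> g (i, j)" "g (i, j) \<le> 1"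
    using g[of "(i, j)"] ij by (auto simp: I_def)
  have gij0: "0 \<le> g (i, j)" by (simp add: g_def)
  have pos: "0 < N * inverse (1 + e)" using N e by simp
  have "1 / ((1 + e) * N) = inverse (1 + e) / N"
    using e by (simp add: field_simps)
  also have "\<dots> \<le> g (i, j) / sum g I"
    using gij gij0 upper less_le_trans[OF pos lower] by (intro frac_le) auto
  finally show "1 / ((1 + e) * N) \<le> emb_similarity n y i j" by (simp add: q)
  have "g (i, j) / sum g I \<le> 1 / (N * inverse (1 + e))"
    using gij gij0 lower pos by (intro frac_le) auto
  also have "\<dots> = (1 + e) / N" using e by (simp add: field_simps)
  finally show "emb_similarity n y i j \<le> (1 + e) / N" by (simp add: q)
qed

text \<open>With \<open>d\<close> the squared distance, the quantity splits as
  \<open>(1/N - q/(1 + d)) - p * d/(1 + d)\<close>. The second term is controlled by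
  \<open>d \<le> e\<close>, the first by the two-sided bounds on \<open>q\<close>.\<close>

lemma S_matrix_entry_bound:
  fixes y :: "nat \<Rightarrow> real ^ 2"
  assumes ij: "i < n" "j < n" "i \<noteq> j" and small: "sq_diam n y < 1"
    and P: "0 \<le> P $$ (i, j)" and a: "0 \<le> a"
  shows "\<bar>S_matrix n P a y $$ (i, j) - a * P $$ (i, j) + 1 / (real n * (real n - 1))\<bar>
      \<le> a * P $$ (i, j) * sq_diam n y
         + 2 * sq_diam n y / (real n * (real n - 1) * (1 - sq_diam n y))"
proof -
  define e d N q p where "e = sq_diam n y" and "d = (norm (y i - y j))\<^sup>2"
    and "N = real n * (real n - 1)" and "q = emb_similarity n y i j" and "p = a * P $$ (i, j)"
  have e: "0 \<le> e" "e < 1" using small by (auto simp: e_def sq_diam_def)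
  have d: "0 \<le> d" "d \<le> e" using sq_dist_le_sq_diam[OF ij(1,2)] by (auto simp: d_def e_def)
  have N: "0 < N" using ij by (auto simp: N_def)
  have p: "0 \<le> p" using P a by (simp add: p_def)
  have q: "1 / ((1 + e) * N) \<le> q" "q \<le> (1 + e) / N"
    using emb_similarity_bounds[OF ij, of y] by (auto simp: e_def N_def q_def)
  have q0: "0 \<le> q" using q(1) e N by (smt (verit) divide_nonneg_nonneg mult_nonneg_nonneg)
  have "d / (1 + d) \<le> e / 1" using d by (intro frac_le) auto
  then have "p * (d / (1 + d)) \<le> p * e" using p by (intro mult_left_mono) auto
  moreover have "0 \<le> p * (d / (1 + d))" using p d by simp
  ultimately have first: "\<bar>p * (d / (1 + d))\<bar> \<le> p * e" by linarith
  have "q / (1 + d) \<le> q / 1" using q0 d by (intro divide_left_mono) auto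
  then have hi: "q / (1 + d) \<le> (1 + e) / N" using q(2) by simp
  \<comment> \<open>The lower bound on \<open>q / (1 + d)\<close> carries the factor
    \<open>1 / (1 + e)^2\<close>: one power from \<open>q\<close>, one from \<open>1 + d\<close>.
    This identity replaces it by its tangent \<open>1 - 2 * e\<close>.\<close>
  have "(1 - 2 * e) * (1 + e)\<^sup>2 = 1 - (3 * e\<^sup>2 + 2 * e ^ 3)"
    by (simp add: power2_eq_square power3_eq_cube algebra_simps)
  moreover have "0 \<le> 3 * e\<^sup>2 + 2 * e ^ 3" using e(1) by (intro add_nonneg_nonneg) auto
  ultimately have "(1 - 2 * e) * (1 + e)\<^sup>2 \<le> 1" by linarith
  then have "1 - 2 * e \<le> 1 / (1 + e)\<^sup>2" using e(1) by (simp add: le_divide_eq)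
  then have "(1 - 2 * e) / N \<le> (1 / (1 + e)\<^sup>2) / N" using N by (intro divide_right_mono) auto
  also have "\<dots> = (1 / ((1 + e) * N)) / (1 + e)" by (simp add: power2_eq_square mult_ac)
  also have "\<dots> \<le> q / (1 + d)" using q q0 d e by (intro frac_le) auto
  finally have lo: "(1 - 2 * e) / N \<le> q / (1 + d)" .
  have "0 \<le> e / N" using e N by simp
  \<comment> \<open>The upper deviation is only \<open>e / N\<close>; the lower one,
    \<open>2 * e / N\<close>, dictates the constant. Dividing by \<open>1 - e\<close> then merely
    enlarges the bound to the required form.\<close>
  then have "\<bar>1 / N - q / (1 + d)\<bar> \<le> 2 * e / N"
    using hi lo by (simp add: add_divide_distrib diff_divide_distrib)
  also have "\<dots> \<le> 2 * e / (N * (1 - e))"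
    using e N by (intro divide_left_mono) (auto simp: mult_le_cancel_left1)
  finally have second: "\<bar>1 / N - q / (1 + d)\<bar> \<le> 2 * e / (N * (1 - e))" .
  have "(p - q) / (1 + d) - p + 1 / N = (1 / N - q / (1 + d)) - p * (d / (1 + d))"
  proof -
    have "p / (1 + d) = p - p * (d / (1 + d))" using d by (simp add: field_simps)
    then show ?thesis by (simp add: diff_divide_distrib)
  qed
  moreover have "S_matrix n P a y $$ (i, j) = (p - q) / (1 + d)"
    using ij by (simp add: S_matrix_def p_def q_def d_def)
  ultimately show ?thesis
    using first second unfolding e_def[symmetric] N_def[symmetric] p_def[symmetric] by linarith
qed

text \<open>The entrywise bound assembles into a nonnegative combination \<open>?B\<close> of
  \<open>P\<close> and \<open>H_matrix n\<close>, which dominates the error matrix; on the diagonal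
  both vanish. Monotonicity and the triangle inequality finish.\<close>

lemma spectral_norm_S_matrix_diff_le:
  fixes y :: "nat \<Rightarrow> real ^ 2"
  assumes n: "2 \<le> n" and a: "0 \<le> a" and small: "sq_diam n y < 1"
    and P: "P \<in> carrier_mat n n" "\<And>i j. i < n \<Longrightarrow> j < n \<Longrightarrow> 0 \<le> P $$ (i, j)"
      "\<And>i. i < n \<Longrightarrow> P $$ (i, i) = 0"
  defines "e \<equiv> sq_diam n y"
  shows "spectral_norm (S_matrix n P a y - (a \<cdot>\<^sub>m P - H_matrix n))
    \<le> e * (a * spectral_norm P) + 2 * e / (1 - e) * (2 / real n)"
proof -
  let ?E = "S_matrix n P a y - (a \<cdot>\<^sub>m P - H_matrix n)"
  let ?B = "(a * e) \<cdot>\<^sub>m P + (2 * e / (1 - e)) \<cdot>\<^sub>m H_matrix n"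
  note H = H_matrix_carrier[of n]
  have e: "0 \<le> e" "e < 1" using small by (auto simp: e_def sq_diam_def)
  have "spectral_norm ?E \<le> spectral_norm ?B"
  proof (rule spectral_norm_mono)
    fix i j assume "i < dim_row ?B" "j < dim_col ?B"
    then have ij: "i < n" "j < n" using H by auto
    show "\<bar>?E $$ (i, j)\<bar> \<le> ?B $$ (i, j)"
    proof (cases "i = j")
      case True
      then show ?thesis
        using ij P H by (simp add: H_matrix_index S_matrix_def)
    next
      case False
      have "?E $$ (i, j) =
          S_matrix n P a y $$ (i, j) - a * P $$ (i, j) + 1 / (real n * (real n - 1))"
        using False ij P(1) H by (simp add: H_matrix_index)
      moreover have "?B $$ (i, j) =
          a * P $$ (i, j) * e + 2 * e / (real n * (real n - 1) * (1 - e))"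
        using False ij P(1) H by (simp add: H_matrix_index mult_ac)
      ultimately show ?thesis
        using S_matrix_entry_bound[OF ij False small P(2)[OF ij] a] by (simp add: e_def)
    qed
  qed (use n P H in \<open>auto simp: S_matrix_def\<close>)
  also have "\<dots> \<le> spectral_norm ((a * e) \<cdot>\<^sub>m P) + spectral_norm ((2 * e / (1 - e)) \<cdot>\<^sub>m H_matrix n)"
    using P H n by (intro spectral_norm_add_le) auto
  also have "\<dots> = a * e * spectral_norm P + 2 * e / (1 - e) * spectral_norm (H_matrix n)"
    using P H n a e by (subst (1 2) spectral_norm_smult) auto
  also have "\<dots> \<le> a * e * spectral_norm P + 2 * e / (1 - e) * (2 / real n)"
    using e spectral_norm_H_matrix_le[OF n] by (intro add_left_mono mult_left_mono) auto
  finally show ?thesis by (simp add: mult_ac)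
qed

text \<open>Reverse triangle inequality, with the bound \<open>2 / n\<close> on the norm of
  \<open>H_matrix n\<close>.\<close>

lemma spectral_norm_diff_H_matrix_ge:
  assumes n: "2 \<le> n" and P: "P \<in> carrier_mat n n" and a: "0 \<le> a"
  shows "a * spectral_norm P - 2 / real n \<le> spectral_norm (a \<cdot>\<^sub>m P - H_matrix n)"
proof -
  note H = H_matrix_carrier[of n]
  have "a * spectral_norm P = spectral_norm (a \<cdot>\<^sub>m P)"
    using P n a by (subst spectral_norm_smult) auto
  also have "a \<cdot>\<^sub>m P = (a \<cdot>\<^sub>m P - H_matrix n) + H_matrix n"
    using P H by (intro eq_matI) auto
  also have "spectral_norm \<dots> \<le> spectral_norm (a \<cdot>\<^sub>m P - H_matrix n) + spectral_norm (H_matrix n)"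
    using P H n by (intro spectral_norm_add_le) (auto simp: minus_mat_def)
  finally show ?thesis using spectral_norm_H_matrix_le[OF n] by linarith
qed

section \<open>Entrywise bound along the iteration and the limit in \<open>n\<close>\<close>

theorem theorem2:
  fixes p :: "nat \<Rightarrow> nat"
    and X :: "nat \<Rightarrow> nat \<Rightarrow> real Matrix.vec"
    and \<tau> :: "nat \<Rightarrow> nat \<Rightarrow> real"
    and \<alpha> h :: "nat \<Rightarrow> real"
    and y0 :: "nat \<Rightarrow> nat \<Rightarrow> real ^ 2"
    and P :: "nat \<Rightarrow> real mat"
    and y :: "nat \<Rightarrow> nat \<Rightarrow> nat \<Rightarrow> real ^ 2"
    and S :: "nat \<Rightarrow> nat \<Rightarrow> real mat"
    and \<eta> :: "nat \<Rightarrow> nat \<Rightarrow> real"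
  assumes data: "\<And>n i. 2 \<le> n \<Longrightarrow> i < n \<Longrightarrow> X n i \<in> carrier_vec (p n)"
    and bandwidth_pos: "\<And>n i. 2 \<le> n \<Longrightarrow> i < n \<Longrightarrow> \<tau> n i > 0"
    and \<alpha>_pos: "\<And>n. 2 \<le> n \<Longrightarrow> \<alpha> n > 0"
    and h_pos: "\<And>n. 2 \<le> n \<Longrightarrow> h n > 0"
    and P_eq: "\<And>n. P n = similarity_matrix n (X n) (\<tau> n)"
    and y_eq: "\<And>n k. y n k = ee_iterate n (P n) (\<alpha> n) (h n) (y0 n) k"
    and S_eq: "\<And>n k. S n k = S_matrix n (P n) (\<alpha> n) (y n k)"
    and \<eta>_eq: "\<And>n k. \<eta> n k = sq_diam n (y n k)"
  shows
    "(\<forall>n\<ge>2. \<forall>k\<ge>1. \<forall>i<n. \<forall>j<n. i \<noteq> j \<longrightarrow> \<eta> n k < 1 \<longrightarrow>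
        \<bar>S n k $$ (i, j) - \<alpha> n * P n $$ (i, j) + 1 / (real n * (real n - 1))\<bar>
          \<le> \<alpha> n * P n $$ (i, j) * \<eta> n k
             + 2 * \<eta> n k / (real n * (real n - 1) * (1 - \<eta> n k)))
     \<and>
     (\<forall>k :: nat \<Rightarrow> nat. (\<forall>n\<ge>2. k n \<ge> 1) \<longrightarrow>
        (\<lambda>n. \<eta> n (k n) / (spectral_norm (P n) / (real n * max_norm (P n))))
          \<longlonglongrightarrow> 0 \<longrightarrow>
        (\<lambda>n. (1 / (real n * spectral_norm (P n))) / \<alpha> n) \<longlonglongrightarrow> 0 \<longrightarrow>
        (\<lambda>n. spectral_norm (S n (k n) - (\<alpha> n \<cdot>\<^sub>m P n - H_matrix n))
               / spectral_norm (\<alpha> n \<cdot>\<^sub>m P n - H_matrix n)) \<longlonglongrightarrow> 0)"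
proof (intro conjI allI impI)
  fix n k i j assume n: "2 \<le> n" and ij: "i < n" "j < n" "i \<noteq> j" and "\<eta> n k < 1"
  then show "\<bar>S n k $$ (i, j) - \<alpha> n * P n $$ (i, j) + 1 / (real n * (real n - 1))\<bar>
      \<le> \<alpha> n * P n $$ (i, j) * \<eta> n k
         + 2 * \<eta> n k / (real n * (real n - 1) * (1 - \<eta> n k))"
    unfolding S_eq \<eta>_eq
    using similarity_matrix_pos[OF ij] \<alpha>_pos[OF n]
    by (intro S_matrix_entry_bound) (auto simp: P_eq less_imp_le)
next
  fix k :: "nat \<Rightarrow> nat"
  define e where "e = (\<lambda>n. \<eta> n (k n))"
  define t where "t = (\<lambda>n. (1 / (real n * spectral_norm (P n))) / \<alpha> n)"
  define r where "r = (\<lambda>n. spectral_norm (P n) / (real n * max_norm (P n)))"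
  let ?R = "\<lambda>n. spectral_norm (S n (k n) - (\<alpha> n \<cdot>\<^sub>m P n - H_matrix n))
               / spectral_norm (\<alpha> n \<cdot>\<^sub>m P n - H_matrix n)"
  assume "(\<lambda>n. \<eta> n (k n) / (spectral_norm (P n) / (real n * max_norm (P n)))) \<longlonglongrightarrow> 0"
  then have er: "(\<lambda>n. e n / r n) \<longlonglongrightarrow> 0" by (simp add: e_def r_def)
  assume "(\<lambda>n. (1 / (real n * spectral_norm (P n))) / \<alpha> n) \<longlonglongrightarrow> 0"
  then have t: "t \<longlonglongrightarrow> 0" by (simp add: t_def)
  have P: "P n \<in> carrier_mat n n" for n
    by (simp add: P_eq similarity_matrix_carrier)
  have P_nonneg: "0 \<le> P n $$ (i, j)" if "i < n" "j < n" for n i j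
    using that similarity_matrix_pos[of i n j] similarity_matrix_diag[of i n]
    by (cases "i = j") (auto simp: P_eq less_imp_le)
  have P_diag: "P n $$ (i, i) = 0" if "i < n" for n i
    using that by (simp add: P_eq similarity_matrix_diag)
  \<comment> \<open>One off-diagonal entry, present as soon as \<open>2 \<le> n\<close>, makes both
    norms of \<open>P n\<close> strictly positive, so the quotients below have nonzero
    denominators.\<close>
  have P01: "0 < \<bar>P n $$ (0, 1)\<bar>" if "2 \<le> n" for n
    using that similarity_matrix_pos[of 0 n 1 "X n" "\<tau> n"] by (simp add: P_eq)
  have norm_pos: "0 < spectral_norm (P n)" and max_pos: "0 < max_norm (P n)" if "2 \<le> n" for n
    using that P01[OF that] abs_index_le_spectral_norm[of 0 "P n" 1]
      abs_index_le_max_norm[of 0 "P n" 1] P[of n] by auto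
  have e_nonneg: "0 \<le> e n" for n by (simp add: e_def \<eta>_eq sq_diam_def)
  \<comment> \<open>The spectral norm is at most \<open>n\<close> times the largest entry, so
    \<open>0 < r n \<le> 1\<close>, and dividing by \<open>r n\<close> can only increase
    \<open>e n\<close>.\<close>
  have "\<bar>e n\<bar> \<le> \<bar>e n / r n\<bar>" if n: "2 \<le> n" for n
  proof -
    have "spectral_norm (P n) \<le> sqrt (dim_row (P n)) * sqrt (dim_col (P n)) * max_norm (P n)"
      using P[of n] n max_pos[OF n] abs_index_le_max_norm[of _ "P n"]
      by (intro spectral_norm_le_entries) auto
    then have r: "0 < r n" "r n \<le> 1"
      using P[of n] n max_pos[OF n] norm_pos[OF n] by (auto simp: r_def divide_le_eq)
    then have "e n * r n \<le> e n * 1" using e_nonneg by (intro mult_left_mono) auto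
    then show ?thesis using r e_nonneg by (simp add: le_divide_eq)
  qed
  then have e: "e \<longlonglongrightarrow> 0"
    by (intro tendsto_rabs_zero_cancel[OF tendsto_sandwich[OF _ _ tendsto_const tendsto_rabs_zero[OF er]]])
      (auto intro!: eventually_sequentiallyI[of 2])
  \<comment> \<open>Numerator and denominator are both measured in units of \<open>A\<close>, the
    product of \<open>\<alpha> n\<close> and the norm of \<open>P n\<close>. Since
    \<open>t n * A = 1 / n\<close>, the factor \<open>A\<close> cancels and a bound in
    \<open>e n\<close> and \<open>t n\<close> alone remains.\<close>
  have bound: "0 \<le> ?R n \<and> ?R n \<le> (e n + 2 * e n / (1 - e n) * (2 * t n)) / (1 - 2 * t n)"
    if n: "2 \<le> n" and small: "e n < 1" "t n < 1 / 2" for n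
  proof -
    define A where "A = \<alpha> n * spectral_norm (P n)"
    have A: "0 < A" using \<alpha>_pos[OF n] norm_pos[OF n] by (simp add: A_def)
    have tA: "2 / real n = 2 * t n * A"
      using \<alpha>_pos[OF n] norm_pos[OF n] n by (simp add: t_def A_def)
    have num: "spectral_norm (S n (k n) - (\<alpha> n \<cdot>\<^sub>m P n - H_matrix n))
        \<le> e n * A + 2 * e n / (1 - e n) * (2 * t n * A)"
      using spectral_norm_S_matrix_diff_le[OF n less_imp_le[OF \<alpha>_pos[OF n]] _ P P_nonneg P_diag,
          where y = "y n (k n)"] small(1)
      unfolding tA by (simp add: S_eq e_def \<eta>_eq A_def)
    have den: "A * (1 - 2 * t n) \<le> spectral_norm (\<alpha> n \<cdot>\<^sub>m P n - H_matrix n)"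
      using spectral_norm_diff_H_matrix_ge[OF n P less_imp_le[OF \<alpha>_pos[OF n]]]
      unfolding tA by (simp add: A_def algebra_simps)
    have pos: "0 < A * (1 - 2 * t n)" using A small by simp
    have num0: "0 \<le> spectral_norm (S n (k n) - (\<alpha> n \<cdot>\<^sub>m P n - H_matrix n))"
      using abs_index_le_spectral_norm[of 0 "S n (k n) - (\<alpha> n \<cdot>\<^sub>m P n - H_matrix n)" 0]
        n P[of n] H_matrix_carrier[of n] by (auto simp: S_eq S_matrix_def)
    have "?R n \<le> (e n * A + 2 * e n / (1 - e n) * (2 * t n * A)) / (A * (1 - 2 * t n))"
      using num den pos num0 by (intro frac_le) auto
    also have "\<dots> = A * (e n + 2 * e n / (1 - e n) * (2 * t n)) / (A * (1 - 2 * t n))"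
      by (simp add: algebra_simps)
    also have "\<dots> = (e n + 2 * e n / (1 - e n) * (2 * t n)) / (1 - 2 * t n)"
      using A by simp
    finally show ?thesis using num0 den pos by auto
  qed
  \<comment> \<open>The threshold 1 for \<open>e n\<close> is the one of the entrywise bound;
    \<open>t n < 1 / 2\<close> keeps the lower bound \<open>A * (1 - 2 * t n)\<close> of the
    denominator positive.\<close>
  have "\<forall>\<^sub>F n in sequentially. 2 \<le> n \<and> e n < 1 \<and> t n < 1 / 2"
    using order_tendstoD(2)[OF e, of 1] order_tendstoD(2)[OF t, of "1 / 2"]
    by (intro eventually_conj eventually_ge_at_top) auto
  then have ev: "\<forall>\<^sub>F n in sequentially.
      0 \<le> ?R n \<and> ?R n \<le> (e n + 2 * e n / (1 - e n) * (2 * t n)) / (1 - 2 * t n)"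
    by eventually_elim (use bound in blast)
  have "(\<lambda>n. (e n + 2 * e n / (1 - e n) * (2 * t n)) / (1 - 2 * t n))
      \<longlonglongrightarrow> (0 + 2 * 0 / (1 - 0) * (2 * 0)) / (1 - 2 * 0)"
    by (intro tendsto_intros e t) auto
  then have lim: "(\<lambda>n. (e n + 2 * e n / (1 - e n) * (2 * t n)) / (1 - 2 * t n)) \<longlonglongrightarrow> 0"
    by simp
  show "?R \<longlonglongrightarrow> 0"
    by (rule tendsto_sandwich[OF _ _ tendsto_const lim]) (use ev in \<open>auto elim: eventually_mono\<close>)
qed

end
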